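(* For every fixed $a<\frac12$, with high probability, for every integer $k$ with $n-n^a\le k\le n$, \[|\mathcal L_k\cap C_{\tau_{\mathrm{end}}}|=1.\]
   Context: Let $n\ge 1$ and $\mathcal B=\{0,1\}^n$ with the coordinatewise partial order; $\mathbf 0=(0,\dots,0)$, $\mathbf 1=(1,\dots,1)$, $|x|$ denotes the number of ones of $x$, and $\mathcal L_k=\{x\in\mathcal B:|x|=k\}$ is the $k$th level. A random decreasing walk from $\mathbf 1$ is a maximal chain $\mathbf 1=x_n>x_{n-1}>\dots>x_0=\mathbf 0$ with $x_i\in\mathcal L_i$, chosen uniformly among all $n!$ such chains (equivalently, each step turns a uniformly random remaining $1$ into $0$). The DLA process on $\mathcal B$: $C_0=\{\mathbf 0\}$; for $t\ge1$, let $\rho_t$ be a random decreasing walk from $\mathbf 1$, independent of everything before; let $v$ be the last vertex of the longest initial segment of $\rho_t$ that is disjoint from $C_{t-1}$, and set $C_t=C_{t-1}\cup\{v\}$. The process terminates at the first time $\tau_{\mathrm{end}}$ with $\mathbf 1\in C_{\tau_{\mathrm{end}}}$. A vertex is occupied at time $t$ if it lies in $C_t$. "With high probability" (w.h.p.) means with probability tending to $1$ as $n\to\infty$. *)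

theory Defs
  imports "HOL-Probability.Probability"
begin

text \<open>Vertices of the hypercube {0,1}^n are encoded as subsets of {0..<n}
(the set of coordinates equal to 1). The top vertex is {0..<n}, the bottom
vertex is the empty set, |x| = card x, and level k is the set of x with card x = k.\<close>

text \<open>A maximal decreasing chain from the top is determined by the order in which
the ones are turned into zeros, i.e. by a permutation sigma (a distinct list
enumerating {0..<n}); its vertices are x_n, x_(n-1), ..., x_0 in walk order.\<close>
definition dwalk :: "nat \<Rightarrow> nat list \<Rightarrow> nat set list" where
  "dwalk n \<sigma> = map (\<lambda>j. {0..<n} - set (take j \<sigma>)) [0..<Suc n]"

definition random_dwalk :: "nat \<Rightarrow> nat set list pmf" where
  "random_dwalk n = map_pmf (dwalk n) (pmf_of_set (permutations_of_set {0..<n}))"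

definition dla_add :: "nat set set \<Rightarrow> nat set list \<Rightarrow> nat set set" where
  "dla_add C \<rho> = (let seg = takeWhile (\<lambda>x. x \<notin> C) \<rho> in
                    if seg = [] then C else insert (last seg) C)"

definition dla_step :: "nat \<Rightarrow> nat set set \<Rightarrow> nat set set pmf" where
  "dla_step n C = map_pmf (dla_add C) (random_dwalk n)"

fun dla_run :: "nat \<Rightarrow> nat \<Rightarrow> nat set set \<Rightarrow> nat set set pmf" where
  "dla_run n 0 C = return_pmf C"
| "dla_run n (Suc m) C =
     (if {0..<n} \<in> C then return_pmf C else bind_pmf (dla_step n C) (dla_run n m))"

text \<open>Distribution of the final cluster C_(tau_end). Each step before termination
adds a new vertex, so the process terminates after at most 2^n - 1 steps and
2^n steps of fuel suffice.\<close>
definition dla_final :: "nat \<Rightarrow> nat set set pmf" where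
  "dla_final n = dla_run n (2 ^ n) {{}}"

end

theory Submission
  imports Defs
begin

text \<open>
Write m(k) for the number of occupied vertices of level k, h for the highest occupied level and
c(k) for the binomial coefficient n over k. One step of the process raises h with probability
exactly m(h) / c(h), and adds a vertex to level k with probability at most m(k - 1) / c(k - 1).
All estimates come from Dynkin's formula for test functions of m(k) and h, which yields linear
inequalities between expected sums, over the steps before termination, of functions of the cluster.

Near the top the ratios c(k + 1) / c(k) are at most some small r. Let W(k) be the expected sum of
m(k) over the steps with h > k. Then the final m(k + 1) has expectation at most 1 + W(k) / c(k), and
W(k + 1) / c(k + 1) is at most 2 r (1 + W(k) / c(k)). Starting from the trivial bound m(k) <= c(k),
this recursion would only just fail to make W(k) / c(k) small. The missing saving is that
at the first time level k + 1 is reached, m(k) is of order sqrt c(k) on average: level k gains at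
most one vertex per step while each step escapes with probability m(k) / c(k). This makes the
recursion contract by r^2 over the first levels considered, until W(k) / c(k) is of the order of a square root
of a binomial coefficient; the simple recursion then finishes. With r of order n^(a - 1), the
sum of W(k) / c(k) over the top n^a levels is of order n^(2 a - 1).
\<close>

section \<open>Walks, clusters and the vertex added by one walk\<close>

text \<open>Indexed by level instead of by number of steps, since hitting probabilities are computed
  level by level.\<close>

definition walk_at :: "nat \<Rightarrow> nat list \<Rightarrow> nat \<Rightarrow> nat set" where
  "walk_at n \<sigma> k = {0..<n} - set (take (n - k) \<sigma>)"

definition level_count :: "nat \<Rightarrow> nat set set \<Rightarrow> nat" where
  "level_count k C = card {x \<in> C. card x = k}"

definition height :: "nat set set \<Rightarrow> nat" where
  "height C = Max (card ` C)"

text \<open>A weak form of connectedness to the bottom: the occupied levels have no gap. It is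
  preserved by every step and makes all level counts up to the height positive.\<close>

definition valid_cluster :: "nat \<Rightarrow> nat set set \<Rightarrow> bool" where
  "valid_cluster n C \<longleftrightarrow> C \<subseteq> Pow {0..<n} \<and> {} \<in> C \<and> (\<forall>x\<in>C. \<forall>k\<le>card x. \<exists>y\<in>C. card y = k)"

lemma dwalk_nth: "j \<le> n \<Longrightarrow> dwalk n \<sigma> ! j = {0..<n} - set (take j \<sigma>)"
  unfolding dwalk_def by (subst nth_map) (auto simp del: upt_Suc)

lemma length_dwalk [simp]: "length (dwalk n \<sigma>) = Suc n"
  by (simp add: dwalk_def)

lemma card_minus_take:
  assumes "\<sigma> \<in> permutations_of_set {0..<n}" "j \<le> n"
  shows "card ({0..<n} - set (take j \<sigma>)) = n - j"
proof -
  have s: "set \<sigma> = {0..<n}" "distinct \<sigma>"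
    using assms by (auto simp: permutations_of_set_def)
  have "length \<sigma> = n" using s distinct_card[of \<sigma>] by simp
  then have "card (set (take j \<sigma>)) = j"
    using s assms by (subst distinct_card) auto
  moreover have "set (take j \<sigma>) \<subseteq> {0..<n}" using s set_take_subset[of j \<sigma>] by simp
  ultimately show ?thesis by (subst card_Diff_subset) auto
qed

text \<open>The walk starts outside \<open>C\<close> and ends at \<open>{}\<close> in
  \<open>C\<close>, so its unoccupied initial segment is nonempty and is followed by a first hit, at
  index \<open>i\<close>. The vertex \<open>v\<close> sits at index \<open>i - 1\<close>, one level
  above that hit and hence above every occupied vertex of the walk.\<close>

lemma dla_add_dwalk:
  assumes \<sigma>: "\<sigma> \<in> permutations_of_set {0..<n}" and e: "{} \<in> C" and top: "{0..<n} \<notin> C"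
  obtains v where "dla_add C (dwalk n \<sigma>) = insert v C" "v \<notin> C" "v \<subseteq> {0..<n}" "0 < card v"
    "walk_at n \<sigma> (card v - 1) \<in> C" "\<And>k. k \<le> n \<Longrightarrow> walk_at n \<sigma> k \<in> C \<Longrightarrow> k < card v"
proof -
  let ?W = "dwalk n \<sigma>"
  define seg where "seg = takeWhile (\<lambda>x. x \<notin> C) ?W"
  define i where "i = length seg"
  have s: "set \<sigma> = {0..<n}" "distinct \<sigma>"
    using \<sigma> by (auto simp: permutations_of_set_def)
  have len: "length \<sigma> = n" using s distinct_card[of \<sigma>] by simp
  have unhit: "?W ! j \<notin> C" if "j < i" for j
    using that nth_mem[of j seg] unfolding seg_def i_def
    by (auto dest!: set_takeWhileD simp: takeWhile_nth)
  have last: "?W ! n \<in> C" using s len e by (simp add: dwalk_nth)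
  have i_le: "i \<le> n" using unhit[of n] last by (cases "i \<le> n") auto
  have hit: "?W ! i \<in> C"
    using nth_length_takeWhile[of "\<lambda>x. x \<notin> C" ?W] i_le unfolding i_def seg_def by auto
  have i_pos: "0 < i"
  proof (rule ccontr)
    assume "\<not> 0 < i"
    with hit top show False by (simp add: dwalk_nth)
  qed
  define v where "v = ?W ! (i - 1)"
  have "seg \<noteq> []" using i_pos i_def by auto
  then have "last seg = v"
    using i_pos unfolding v_def i_def by (simp add: last_conv_nth seg_def takeWhile_nth)
  then have 1: "dla_add C ?W = insert v C"
    using \<open>seg \<noteq> []\<close> unfolding dla_add_def seg_def[symmetric] by simp
  have v: "v = {0..<n} - set (take (i - 1) \<sigma>)"
    unfolding v_def using i_le by (intro dwalk_nth) auto
  have card_v: "card v = Suc (n - i)"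
    unfolding v using card_minus_take[OF \<sigma>, of "i - 1"] i_le i_pos by simp
  show ?thesis
  proof (rule that[OF 1])
    show "v \<notin> C" unfolding v_def using unhit i_pos by simp
    show "v \<subseteq> {0..<n}" using v by auto
    show "0 < card v" using card_v by simp
    show "walk_at n \<sigma> (card v - 1) \<in> C"
      using hit i_le by (simp add: card_v walk_at_def dwalk_nth)
  next
    fix k assume k: "k \<le> n" "walk_at n \<sigma> k \<in> C"
    then have "?W ! (n - k) \<in> C" by (simp add: dwalk_nth walk_at_def)
    then have "\<not> n - k < i" using unhit by blast
    then show "k < card v" using card_v k by simp
  qed
qed

section \<open>Law of the walk on a fixed level\<close>

text \<open>Cutting at position \<open>card B\<close> puts these permutations in bijection with
  pairs of a permutation of \<open>B\<close> and one of \<open>A - B\<close>.\<close>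

lemma card_permutations_set_take:
  assumes "finite A" "B \<subseteq> A"
  shows "card {\<sigma> \<in> permutations_of_set A. set (take (card B) \<sigma>) = B}
          = fact (card B) * fact (card A - card B)"
proof -
  have fB: "finite B" using assms finite_subset by blast
  let ?app = "\<lambda>(xs, ys). xs @ ys :: 'a list"
  let ?P = "permutations_of_set B \<times> permutations_of_set (A - B)"
  have len: "length xs = card B" if "xs \<in> permutations_of_set B" for xs
    using that distinct_card[of xs] by (auto simp: permutations_of_set_def)
  have "{\<sigma> \<in> permutations_of_set A. set (take (card B) \<sigma>) = B} = ?app ` ?P" (is "?L = _")
  proof (intro equalityI subsetI)
    fix \<sigma> assume "\<sigma> \<in> ?L"
    then have s: "set \<sigma> = A" "distinct \<sigma>" "set (take (card B) \<sigma>) = B"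
      by (auto simp: permutations_of_set_def)
    have split: "set \<sigma> = set (take (card B) \<sigma>) \<union> set (drop (card B) \<sigma>)"
      by (metis append_take_drop_id set_append)
    have "set (take (card B) \<sigma>) \<inter> set (drop (card B) \<sigma>) = {}"
      using set_take_disj_set_drop_if_distinct[OF s(2), of "card B" "card B"] by simp
    with split s have "set (drop (card B) \<sigma>) = A - B" by auto
    then have "(take (card B) \<sigma>, drop (card B) \<sigma>) \<in> ?P"
      using s by (auto simp: permutations_of_set_def)
    then show "\<sigma> \<in> ?app ` ?P" by (intro image_eqI) auto
  next
    fix \<sigma> assume "\<sigma> \<in> ?app ` ?P"
    then obtain xs ys where "xs \<in> permutations_of_set B" "ys \<in> permutations_of_set (A - B)"
      "\<sigma> = xs @ ys" by auto
    then show "\<sigma> \<in> ?L" using len[of xs] assms by (auto simp: permutations_of_set_def)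
  qed
  moreover have "inj_on ?app ?P" using len by (auto simp: inj_on_def)
  ultimately have "card ?L = card ?P" by (simp add: card_image)
  also have "\<dots> = fact (card B) * fact (card A - card B)"
    using assms fB by (simp add: card_cartesian_product card_Diff_subset)
  finally show ?thesis .
qed

text \<open>The walk is uniform on each level: every vertex of level k is visited by
  \<open>fact (n - k) * fact k\<close> of the \<open>fact n\<close> permutations, and these events
  are disjoint for distinct vertices.\<close>

lemma prob_walk_at:
  assumes C: "C \<subseteq> Pow {0..<n}" and k: "k \<le> n"
  shows "measure_pmf.prob (pmf_of_set (permutations_of_set {0..<n})) {\<sigma>. walk_at n \<sigma> k \<in> C}
          = real (level_count k C) / real (n choose k)"
proof -
  let ?S = "permutations_of_set {0..<n}"
  let ?X = "{x \<in> C. card x = k}"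
  let ?E = "\<lambda>x. {\<sigma> \<in> ?S. set (take (n - k) \<sigma>) = {0..<n} - x}"
  have fC: "finite C" using C finite_subset by blast
  have "?S \<inter> {\<sigma>. walk_at n \<sigma> k \<in> C} = (\<Union>x\<in>?X. ?E x)"
  proof (intro equalityI subsetI)
    fix \<sigma> assume *: "\<sigma> \<in> ?S \<inter> {\<sigma>. walk_at n \<sigma> k \<in> C}"
    then have "card (walk_at n \<sigma> k) = k"
      unfolding walk_at_def using card_minus_take[of \<sigma> n "n - k"] k by simp
    moreover have "set (take (n - k) \<sigma>) \<subseteq> {0..<n}"
      using * set_take_subset[of "n - k" \<sigma>] by (auto simp: permutations_of_set_def)
    then have "set (take (n - k) \<sigma>) = {0..<n} - walk_at n \<sigma> k"
      unfolding walk_at_def by auto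
    ultimately show "\<sigma> \<in> (\<Union>x\<in>?X. ?E x)" using * by auto
  next
    fix \<sigma> assume "\<sigma> \<in> (\<Union>x\<in>?X. ?E x)"
    then obtain x where x: "x \<in> C" "\<sigma> \<in> ?S" "set (take (n - k) \<sigma>) = {0..<n} - x" by auto
    then have "walk_at n \<sigma> k = x" using C unfolding walk_at_def by auto
    then show "\<sigma> \<in> ?S \<inter> {\<sigma>. walk_at n \<sigma> k \<in> C}" using x by auto
  qed
  moreover have "card (\<Union>x\<in>?X. ?E x) = (\<Sum>x\<in>?X. card (?E x))"
  proof (rule card_UN_disjoint)
    show "finite ?X" using fC by simp
    show "\<forall>i\<in>?X. finite (?E i)" by simp
    show "\<forall>i\<in>?X. \<forall>j\<in>?X. i \<noteq> j \<longrightarrow> ?E i \<inter> ?E j = {}" using C by auto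
  qed
  moreover have "card (?E x) = fact (n - k) * fact k" if "x \<in> ?X" for x
  proof -
    have "x \<subseteq> {0..<n}" "card x = k" using that C by auto
    then have "card ({0..<n} - x) = n - k" by (simp add: card_Diff_subset finite_subset)
    then show ?thesis
      using card_permutations_set_take[of "{0..<n}" "{0..<n} - x"] k by simp
  qed
  ultimately have "card (?S \<inter> {\<sigma>. walk_at n \<sigma> k \<in> C}) = level_count k C * (fact (n - k) * fact k)"
    by (simp add: level_count_def)
  then have "measure_pmf.prob (pmf_of_set ?S) {\<sigma>. walk_at n \<sigma> k \<in> C}
              = real (level_count k C * (fact (n - k) * fact k)) / fact n"
    by (simp add: measure_pmf_of_set)
  then show ?thesis using k by (simp add: binomial_fact field_simps)
qed

section \<open>Level counts and height of a cluster\<close>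

lemma valid_cluster_finite: "valid_cluster n C \<Longrightarrow> finite C"
  unfolding valid_cluster_def using finite_subset by blast

lemma valid_cluster_height:
  assumes "valid_cluster n C"
  shows "\<And>x. x \<in> C \<Longrightarrow> card x \<le> height C" "height C \<le> n" "\<exists>x\<in>C. card x = height C"
proof -
  have f: "finite (card ` C)" "card ` C \<noteq> {}"
    using assms valid_cluster_finite[OF assms] by (auto simp: valid_cluster_def)
  then show "\<And>x. x \<in> C \<Longrightarrow> card x \<le> height C" unfolding height_def by (simp add: Max_ge)
  show ex: "\<exists>x\<in>C. card x = height C" using Max_in[OF f] unfolding height_def by auto
  then obtain x where "x \<in> C" "card x = height C" by auto
  moreover from this have "x \<subseteq> {0..<n}" using assms by (auto simp: valid_cluster_def)
  ultimately show "height C \<le> n" using card_mono[of "{0..<n}" x] by simp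
qed

lemma valid_cluster_height_less:
  assumes "valid_cluster n C" "{0..<n} \<notin> C"
  shows "height C < n"
proof (rule ccontr)
  assume "\<not> height C < n"
  then obtain x where x: "x \<in> C" "card x = n"
    using valid_cluster_height[OF assms(1)] by (metis le_antisym not_less)
  then have "x = {0..<n}" using assms(1) by (intro card_subset_eq) (auto simp: valid_cluster_def)
  with x assms show False by simp
qed

lemma level_count_pos:
  assumes "valid_cluster n C" "k \<le> height C"
  shows "1 \<le> level_count k C"
proof -
  obtain x where "x \<in> C" "card x = height C" using valid_cluster_height[OF assms(1)] by auto
  then have "\<exists>y\<in>C. card y = k" using assms by (auto simp: valid_cluster_def)
  then have "{x \<in> C. card x = k} \<noteq> {}" by auto
  then show ?thesis using valid_cluster_finite[OF assms(1)]
    by (simp add: level_count_def Suc_le_eq card_gt_0_iff)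
qed

lemma level_count_zero:
  assumes "valid_cluster n C" "height C < k"
  shows "level_count k C = 0"
proof -
  have "{x \<in> C. card x = k} = {}" using valid_cluster_height(1)[OF assms(1)] assms(2) by force
  then show ?thesis unfolding level_count_def by (simp only: card.empty)
qed

lemma level_count_le_binomial:
  assumes "valid_cluster n C"
  shows "level_count k C \<le> n choose k"
proof -
  have "level_count k C \<le> card {B. B \<subseteq> {0..<n} \<and> card B = k}"
    unfolding level_count_def using assms by (intro card_mono) (auto simp: valid_cluster_def)
  then show ?thesis using n_subsets[of "{0..<n}" k] by simp
qed

lemma level_count_insert:
  assumes "finite C" "v \<notin> C"
  shows "level_count k (insert v C) = (if card v = k then level_count k C + 1 else level_count k C)"
proof -
  have "{x \<in> insert v C. card x = k} =
      (if card v = k then insert v {x \<in> C. card x = k} else {x \<in> C. card x = k})"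
    by auto
  then show ?thesis using assms by (simp add: level_count_def)
qed

lemma height_insert:
  assumes "finite C" "C \<noteq> {}"
  shows "height (insert v C) = max (card v) (height C)"
  using assms by (simp add: height_def)

lemma valid_cluster_init: "valid_cluster n {{}}" by (auto simp: valid_cluster_def)

lemma height_init: "height {{}} = 0" by (simp add: height_def)

section \<open>One step of the process\<close>

lemma dla_step_eq:
  "dla_step n C = map_pmf (\<lambda>\<sigma>. dla_add C (dwalk n \<sigma>)) (pmf_of_set (permutations_of_set {0..<n}))"
  by (simp add: dla_step_def random_dwalk_def map_pmf_comp)

lemma finite_set_pmf_dla_step: "finite (set_pmf (dla_step n C))"
  by (simp add: dla_step_eq)

text \<open>The occupied vertex that stops the walk lies one level below the new vertex, so no gap
  arises. The growth of the cardinality later shows that the fuel suffices.\<close>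

lemma valid_cluster_dla_step:
  assumes "valid_cluster n C" "{0..<n} \<notin> C" "C' \<in> set_pmf (dla_step n C)"
  shows "valid_cluster n C'" "card C' = Suc (card C)"
proof -
  obtain \<sigma> where \<sigma>: "\<sigma> \<in> permutations_of_set {0..<n}" "C' = dla_add C (dwalk n \<sigma>)"
    using assms(3) by (auto simp: dla_step_eq)
  have e: "{} \<in> C" using assms by (simp add: valid_cluster_def)
  obtain v where v: "C' = insert v C" "v \<notin> C" "v \<subseteq> {0..<n}" "0 < card v"
    "walk_at n \<sigma> (card v - 1) \<in> C"
    using dla_add_dwalk[OF \<sigma>(1) e assms(2)] \<sigma>(2) by metis
  show "card C' = Suc (card C)" using v valid_cluster_finite[OF assms(1)] by simp
  have "card v \<le> n" using v card_mono[of "{0..<n}" v] by simp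
  then have w: "card (walk_at n \<sigma> (card v - 1)) = card v - 1"
    unfolding walk_at_def using card_minus_take[OF \<sigma>(1), of "n - (card v - 1)"] by simp
  have "\<exists>y\<in>insert v C. card y = k" if "k \<le> card v" for k
  proof (cases "k = card v")
    case False
    then have "k \<le> card (walk_at n \<sigma> (card v - 1))" using that w by simp
    then show ?thesis using v(5) assms(1) by (auto simp: valid_cluster_def)
  qed auto
  then show "valid_cluster n C'" using assms(1) v unfolding valid_cluster_def v(1) by auto
qed

text \<open>Here \<open>q\<close> is the probability that the new vertex lies on level k. It is only
  bounded above, since a hit on level k - 1 is necessary but the walk may have been stopped higher
  up. At the height nothing higher is occupied, so a hit there is equivalent to a rise and that
  probability is exact. The new vertex has one level, at most \<open>height C + 1\<close>, which
  gives the two separate terms of the drift.\<close>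

lemma dla_step_generator:
  assumes C: "valid_cluster n C" and top: "{0..<n} \<notin> C" and k: "0 < k"
  obtains q where "0 \<le> q" "q \<le> 1" "q \<le> real (level_count (k - 1) C) / real (n choose (k - 1))"
    "\<And>f :: nat \<Rightarrow> nat \<Rightarrow> real. (\<integral>C'. f (level_count k C') (height C') \<partial>dla_step n C) - f (level_count k C) (height C) =
       (if k \<le> height C then q * (f (level_count k C + 1) (height C) - f (level_count k C) (height C)) else 0) +
       real (level_count (height C) C) / real (n choose height C) *
         (f (level_count k C + (if k = height C + 1 then 1 else 0)) (height C + 1) - f (level_count k C) (height C))"
proof -
  let ?S = "permutations_of_set {0..<n}"
  let ?P = "pmf_of_set ?S"
  let ?h = "height C"
  have setP: "set_pmf ?P = ?S" by simp
  define new where "new \<sigma> = (SOME v. dla_add C (dwalk n \<sigma>) = insert v C \<and> v \<notin> C \<and> v \<subseteq> {0..<n}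
      \<and> 0 < card v \<and> walk_at n \<sigma> (card v - 1) \<in> C \<and>
     (\<forall>k. k \<le> n \<longrightarrow> walk_at n \<sigma> k \<in> C \<longrightarrow> k < card v))" for \<sigma>
  have e: "{} \<in> C" using C by (simp add: valid_cluster_def)
  have new: "dla_add C (dwalk n \<sigma>) = insert (new \<sigma>) C \<and> new \<sigma> \<notin> C \<and> new \<sigma> \<subseteq> {0..<n}
      \<and> 0 < card (new \<sigma>) \<and> walk_at n \<sigma> (card (new \<sigma>) - 1) \<in> C \<and>
     (\<forall>k. k \<le> n \<longrightarrow> walk_at n \<sigma> k \<in> C \<longrightarrow> k < card (new \<sigma>))" if "\<sigma> \<in> ?S" for \<sigma>
    unfolding new_def by (rule someI_ex) (use dla_add_dwalk[OF that e top] in metis)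
  define q where "q = measure_pmf.prob ?P {\<sigma>. card (new \<sigma>) = k}"
  have h_less: "?h < n" using valid_cluster_height_less[OF C top] .
  have new_le: "card (new \<sigma>) \<le> ?h + 1" if "\<sigma> \<in> ?S" for \<sigma>
  proof -
    have "card (new \<sigma>) \<le> n" using new[OF that] card_mono[of "{0..<n}" "new \<sigma>"] by simp
    then have "card (walk_at n \<sigma> (card (new \<sigma>) - 1)) = card (new \<sigma>) - 1"
      unfolding walk_at_def using card_minus_take[OF that, of "n - (card (new \<sigma>) - 1)"] by simp
    then show ?thesis using new[OF that] valid_cluster_height(1)[OF C] by force
  qed
  have fin: "finite (set_pmf ?P)" using setP by simp
  have qle: "q \<le> real (level_count (k - 1) C) / real (n choose (k - 1))"
  proof (cases "k - 1 \<le> n")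
    case True
    have "q \<le> measure_pmf.prob ?P {\<sigma>. walk_at n \<sigma> (k - 1) \<in> C}"
      unfolding q_def
      by (rule measure_pmf.finite_measure_mono_AE) (use new in \<open>auto simp: AE_measure_pmf_iff\<close>)
    then show ?thesis using prob_walk_at[of C n "k - 1"] True C by (auto simp: valid_cluster_def)
  next
    case False
    \<comment> \<open>In this case \<open>n choose (k - 1)\<close> is 0 and the bound, a division by
      0, equals 0; no vertex has level k.\<close>
    have "q = 0" unfolding q_def
      using new_le h_less False by (force simp: measure_pmf_zero_iff)
    then show ?thesis by simp
  qed
  have up: "measure_pmf.prob ?P {\<sigma>. card (new \<sigma>) = ?h + 1} = real (level_count ?h C) / real (n choose ?h)"
  proof -
    have "measure_pmf.prob ?P {\<sigma>. card (new \<sigma>) = ?h + 1}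
        = measure_pmf.prob ?P {\<sigma>. walk_at n \<sigma> ?h \<in> C}"
    proof (rule measure_pmf.finite_measure_eq_AE)
      have "card (new \<sigma>) = ?h + 1 \<longleftrightarrow> walk_at n \<sigma> ?h \<in> C" if "\<sigma> \<in> ?S" for \<sigma>
      proof
        assume "card (new \<sigma>) = ?h + 1"
        then show "walk_at n \<sigma> ?h \<in> C" using new[OF that] by simp
      next
        assume "walk_at n \<sigma> ?h \<in> C"
        then have "?h < card (new \<sigma>)" using new[OF that] h_less by simp
        then show "card (new \<sigma>) = ?h + 1" using new_le[OF that] by simp
      qed
      then show "AE x in measure_pmf ?P. (x \<in> {\<sigma>. card (new \<sigma>) = ?h + 1}) = (x \<in> {\<sigma>. walk_at n \<sigma> ?h \<in> C})"
        by (auto simp: AE_measure_pmf_iff)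
    qed auto
    then show ?thesis using prob_walk_at[of C n ?h] h_less C by (simp add: valid_cluster_def)
  qed
  show ?thesis
  proof (rule that[of q])
    show "0 \<le> q" "q \<le> 1" by (simp_all add: q_def)
    show "q \<le> real (level_count (k - 1) C) / real (n choose (k - 1))" by (rule qle)
    fix f :: "nat \<Rightarrow> nat \<Rightarrow> real"
    let ?a = "f (level_count k C + 1) ?h - f (level_count k C) ?h"
    let ?b = "f (level_count k C + (if k = ?h + 1 then 1 else 0)) (?h + 1) - f (level_count k C) ?h"
    have Cne: "finite C" "C \<noteq> {}" using e valid_cluster_finite[OF C] by auto
    have pt: "f (level_count k (dla_add C (dwalk n \<sigma>))) (height (dla_add C (dwalk n \<sigma>))) =
        f (level_count k C) ?h + (if k \<le> ?h then ?a else 0) * indicator {\<sigma>. card (new \<sigma>) = k} \<sigma>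
         + ?b * indicator {\<sigma>. card (new \<sigma>) = ?h + 1} \<sigma>" if "\<sigma> \<in> ?S" for \<sigma>
    proof (cases "card (new \<sigma>) = ?h + 1")
      case False
      then have "card (new \<sigma>) \<le> ?h" using new_le[OF that] by simp
      then show ?thesis
        using new[OF that] Cne by (auto simp: level_count_insert height_insert indicator_def max_def)
    qed (use new[OF that] Cne in \<open>auto simp: level_count_insert height_insert indicator_def max_def\<close>)
    have "(\<integral>C'. f (level_count k C') (height C') \<partial>dla_step n C) =
      (\<integral>\<sigma>. f (level_count k (dla_add C (dwalk n \<sigma>))) (height (dla_add C (dwalk n \<sigma>))) \<partial>?P)"
      by (simp add: dla_step_eq)
    also have "\<dots> = (\<integral>\<sigma>. f (level_count k C) ?h + (if k \<le> ?h then ?a else 0) * indicator {\<sigma>. card (new \<sigma>) = k} \<sigma>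
         + ?b * indicator {\<sigma>. card (new \<sigma>) = ?h + 1} \<sigma> \<partial>?P)"
      by (rule integral_cong_AE) (auto simp: AE_measure_pmf_iff pt)
    also have "\<dots> = f (level_count k C) ?h + (if k \<le> ?h then ?a else 0) * q
        + ?b * measure_pmf.prob ?P {\<sigma>. card (new \<sigma>) = ?h + 1}"
      unfolding q_def
      by (subst Bochner_Integration.integral_add Bochner_Integration.integral_add,
          (intro integrable_measure_pmf_finite fin)+)+ simp
    finally show "(\<integral>C'. f (level_count k C') (height C') \<partial>dla_step n C) - f (level_count k C) (height C) =
       (if k \<le> height C then q * (f (level_count k C + 1) (height C) - f (level_count k C) (height C)) else 0) +
       real (level_count (height C) C) / real (n choose height C) *
         (f (level_count k C + (if k = height C + 1 then 1 else 0)) (height C + 1) - f (level_count k C) (height C))"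
      unfolding up by (simp add: algebra_simps)
  qed
qed

section \<open>Expected sums before termination and Dynkin's formula\<close>

text \<open>Expected sum of g over the clusters visited before termination, within m steps.\<close>
fun occ_run :: "nat \<Rightarrow> nat \<Rightarrow> nat set set \<Rightarrow> (nat set set \<Rightarrow> real) \<Rightarrow> real" where
  "occ_run n 0 C g = 0"
| "occ_run n (Suc m) C g =
     (if {0..<n} \<in> C then 0 else g C + (\<integral>C'. occ_run n m C' g \<partial>dla_step n C))"

lemma integrable_dla_step: "integrable (measure_pmf (dla_step n C)) (f :: _ \<Rightarrow> real)"
  by (intro integrable_measure_pmf_finite finite_set_pmf_dla_step)

lemma occ_run_mono:
  assumes "valid_cluster n C" "\<And>C. valid_cluster n C \<Longrightarrow> {0..<n} \<notin> C \<Longrightarrow> g C \<le> g' C"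
  shows "occ_run n m C g \<le> occ_run n m C g'"
  using assms(1)
proof (induction m arbitrary: C)
  case (Suc m)
  have "(\<integral>C'. occ_run n m C' g \<partial>dla_step n C) \<le> (\<integral>C'. occ_run n m C' g' \<partial>dla_step n C)"
    if "{0..<n} \<notin> C"
    by (rule integral_mono_AE)
      (use Suc that valid_cluster_dla_step in \<open>auto simp: AE_measure_pmf_iff intro!: integrable_dla_step\<close>)
  then show ?case using assms(2)[OF Suc.prems] by (simp add: add_mono)
qed simp

lemma occ_run_add: "occ_run n m C (\<lambda>C. g C + g' C) = occ_run n m C g + occ_run n m C g'"
  by (induction m arbitrary: C)
    (auto simp: Bochner_Integration.integral_add integrable_dla_step)

lemma occ_run_cmult: "occ_run n m C (\<lambda>C. r * g C) = r * occ_run n m C g"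
  by (induction m arbitrary: C) (auto simp: algebra_simps)

lemma finite_set_pmf_dla_run: "finite (set_pmf (dla_run n m C))"
  by (induction m arbitrary: C) (auto simp: finite_set_pmf_dla_step)

lemma integrable_dla_run: "integrable (measure_pmf (dla_run n m C)) (f :: _ \<Rightarrow> real)"
  by (intro integrable_measure_pmf_finite finite_set_pmf_dla_run)

lemma valid_cluster_dla_run:
  "valid_cluster n C \<Longrightarrow> C' \<in> set_pmf (dla_run n m C) \<Longrightarrow> valid_cluster n C'"
  by (induction m arbitrary: C) (auto split: if_splits dest: valid_cluster_dla_step)

text \<open>\<open>card C + m\<close> never decreases while the process runs, so a run that exhausts
  its fuel has filled all of \<open>Pow {0..<n}\<close>, including the top.\<close>

lemma dla_run_terminates:
  assumes "valid_cluster n C" "2 ^ n \<le> card C + m" "C' \<in> set_pmf (dla_run n m C)"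
  shows "{0..<n} \<in> C'"
  using assms
proof (induction m arbitrary: C)
  case 0
  have "C = Pow {0..<n}"
    using 0 by (intro card_subset_eq) (auto simp: valid_cluster_def card_Pow intro!: antisym
      card_mono[of "Pow {0..<n}" C, simplified card_Pow, simplified])
  then show ?case using 0 by auto
next
  case (Suc m)
  show ?case
  proof (cases "{0..<n} \<in> C")
    case False
    then obtain D where "D \<in> set_pmf (dla_step n C)" "C' \<in> set_pmf (dla_run n m D)"
      using Suc.prems by auto
    then show ?thesis using Suc.IH[of D] valid_cluster_dla_step[OF Suc.prems(1) False, of D] Suc.prems by simp
  qed (use Suc.prems in simp)
qed

lemma integral_bind_pmf_finite:
  fixes f :: "'b \<Rightarrow> real"
  assumes "finite (set_pmf p)" "\<And>x. x \<in> set_pmf p \<Longrightarrow> finite (set_pmf (q x))"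
  shows "(\<integral>y. f y \<partial>bind_pmf p q) = (\<integral>x. (\<integral>y. f y \<partial>q x) \<partial>p)"
proof -
  let ?B = "\<Union>x\<in>set_pmf p. set_pmf (q x)"
  have "(\<integral>y. f y \<partial>bind_pmf p q) = (\<Sum>y\<in>?B. f y * pmf (bind_pmf p q) y)"
    by (rule integral_measure_pmf_real) (use assms in auto)
  also have "\<dots> = (\<Sum>y\<in>?B. \<Sum>x\<in>set_pmf p. pmf p x * (f y * pmf (q x) y))"
    by (simp add: pmf_bind integral_measure_pmf[OF assms(1)] sum_distrib_left mult_ac)
  also have "\<dots> = (\<Sum>x\<in>set_pmf p. \<Sum>y\<in>?B. pmf p x * (f y * pmf (q x) y))"
    by (rule sum.swap)
  also have "\<dots> = (\<Sum>x\<in>set_pmf p. pmf p x * (\<integral>y. f y \<partial>q x))"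
  proof (rule sum.cong[OF refl])
    fix x assume "x \<in> set_pmf p"
    then have "(\<integral>y. f y \<partial>q x) = (\<Sum>y\<in>?B. f y * pmf (q x) y)"
      by (intro integral_measure_pmf_real) (use assms in auto)
    then show "(\<Sum>y\<in>?B. pmf p x * (f y * pmf (q x) y)) = pmf p x * (\<integral>y. f y \<partial>q x)"
      by (simp add: sum_distrib_left)
  qed
  also have "\<dots> = (\<integral>x. (\<integral>y. f y \<partial>q x) \<partial>p)"
    by (simp add: integral_measure_pmf[OF assms(1)])
  finally show ?thesis .
qed

text \<open>The one-step drifts telescope along the run. \<open>occ_run\<close> and
  \<open>dla_run\<close> stop at the same moment, so the identity is exact for every amount of
  fuel.\<close>

lemma dynkin:
  "(\<integral>C'. F C' \<partial>dla_run n m C) = F C + occ_run n m C (\<lambda>C. (\<integral>C'. F C' \<partial>dla_step n C) - F C)"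
proof (induction m arbitrary: C)
  case (Suc m)
  show ?case
  proof (cases "{0..<n} \<in> C")
    case False
    let ?g = "\<lambda>C. (\<integral>C'. F C' \<partial>dla_step n C) - F C"
    have "(\<integral>C'. F C' \<partial>dla_run n (Suc m) C) = (\<integral>D. (\<integral>C'. F C' \<partial>dla_run n m D) \<partial>dla_step n C)"
      using False by (simp add: integral_bind_pmf_finite finite_set_pmf_dla_step finite_set_pmf_dla_run)
    also have "\<dots> = (\<integral>D. F D + occ_run n m D ?g \<partial>dla_step n C)" by (simp add: Suc)
    also have "\<dots> = (\<integral>D. F D \<partial>dla_step n C) + (\<integral>D. occ_run n m D ?g \<partial>dla_step n C)"
      by (rule Bochner_Integration.integral_add) (rule integrable_dla_step)+
    finally show ?thesis using False by simp
  qed simp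
qed simp

text \<open>The fuel \<open>2 ^ n\<close> exceeds every possible number of steps, so nothing is
  truncated.\<close>

definition occupation :: "nat \<Rightarrow> (nat set set \<Rightarrow> real) \<Rightarrow> real" where
  "occupation n g = occ_run n (2 ^ n) {{}} g"

lemma occupation_mono:
  assumes "\<And>C. valid_cluster n C \<Longrightarrow> height C < n \<Longrightarrow> g C \<le> g' C"
  shows "occupation n g \<le> occupation n g'"
  unfolding occupation_def using assms valid_cluster_height_less by (intro occ_run_mono[OF valid_cluster_init]) auto

lemma occupation_add: "occupation n (\<lambda>C. g C + g' C) = occupation n g + occupation n g'"
  by (simp add: occupation_def occ_run_add)

lemma occupation_cmult: "occupation n (\<lambda>C. r * g C) = r * occupation n g"
  by (simp add: occupation_def occ_run_cmult)

lemma occupation_zero: "occupation n (\<lambda>C. 0) = 0"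
  using occupation_cmult[of n 0 "\<lambda>C. 0"] by simp

lemma occupation_sum: "occupation n (\<lambda>C. \<Sum>i\<in>I. g i C) = (\<Sum>i\<in>I. occupation n (g i))"
  by (induction I rule: infinite_finite_induct) (simp_all add: occupation_zero occupation_add)

lemma occupation_nonneg:
  assumes "\<And>C. 0 \<le> g C"
  shows "0 \<le> occupation n g"
  using occupation_mono[of n "\<lambda>C. 0" g] assms by (simp add: occupation_zero)

section \<open>Linear inequalities from test functions\<close>

text \<open>Dynkin's formula with the drift of \<open>f\<close> replaced by an upper bound
  \<open>g\<close>, valid for every admissible \<open>q\<close>. The term \<open>f 0 0\<close> is
  the value at the initial cluster, whose level k is empty. Each estimate below is one choice of
  \<open>f\<close> and \<open>g\<close>.\<close>

lemma occupation_test: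
  fixes f :: "nat \<Rightarrow> nat \<Rightarrow> real"
  assumes k: "0 < k"
    and gen: "\<And>C q. \<lbrakk>valid_cluster n C; height C < n; 0 \<le> q; q \<le> 1;
        q \<le> real (level_count (k - 1) C) / real (n choose (k - 1))\<rbrakk> \<Longrightarrow>
       (if k \<le> height C then q * (f (level_count k C + 1) (height C) - f (level_count k C) (height C)) else 0) +
       real (level_count (height C) C) / real (n choose height C) *
         (f (level_count k C + (if k = height C + 1 then 1 else 0)) (height C + 1) - f (level_count k C) (height C)) \<le> g C"
  shows "(\<integral>C. f (level_count k C) (height C) \<partial>dla_final n) \<le> f 0 0 + occupation n g"
proof -
  let ?F = "\<lambda>C. f (level_count k C) (height C)"
  have "(\<integral>C. ?F C \<partial>dla_final n) =
      ?F {{}} + occ_run n (2 ^ n) {{}} (\<lambda>C. (\<integral>C'. ?F C' \<partial>dla_step n C) - ?F C)"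
    unfolding dla_final_def by (rule dynkin)
  also have "occ_run n (2 ^ n) {{}} (\<lambda>C. (\<integral>C'. ?F C' \<partial>dla_step n C) - ?F C) \<le> occupation n g"
    unfolding occupation_def
  proof (rule occ_run_mono[OF valid_cluster_init])
    fix C assume C: "valid_cluster n C" "{0..<n} \<notin> C"
    show "(\<integral>C'. ?F C' \<partial>dla_step n C) - ?F C \<le> g C"
    proof (rule dla_step_generator[OF C k])
      fix q assume q: "0 \<le> q" "q \<le> 1" "q \<le> real (level_count (k - 1) C) / real (n choose (k - 1))"
        and eq: "\<And>f :: nat \<Rightarrow> nat \<Rightarrow> real. (\<integral>C'. f (level_count k C') (height C') \<partial>dla_step n C) - f (level_count k C) (height C) =
         (if k \<le> height C then q * (f (level_count k C + 1) (height C) - f (level_count k C) (height C)) else 0) +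
         real (level_count (height C) C) / real (n choose height C) *
           (f (level_count k C + (if k = height C + 1 then 1 else 0)) (height C + 1) - f (level_count k C) (height C))"
      show ?thesis unfolding eq[of f] by (rule gen[OF C(1) valid_cluster_height_less[OF C] q])
    qed
  qed
  finally show ?thesis using k level_count_zero[OF valid_cluster_init, of k] by (simp add: height_init)
qed

text \<open>Dropping a nonnegative left-hand side lets the negative terms of \<open>g\<close> be
  bounded by the positive ones.\<close>

lemma occupation_test_nonneg:
  fixes f :: "nat \<Rightarrow> nat \<Rightarrow> real"
  assumes "0 < k" "\<And>m h. 0 \<le> f m h"
    and "\<And>C q. \<lbrakk>valid_cluster n C; height C < n; 0 \<le> q; q \<le> 1;
        q \<le> real (level_count (k - 1) C) / real (n choose (k - 1))\<rbrakk> \<Longrightarrow>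
       (if k \<le> height C then q * (f (level_count k C + 1) (height C) - f (level_count k C) (height C)) else 0) +
       real (level_count (height C) C) / real (n choose height C) *
         (f (level_count k C + (if k = height C + 1 then 1 else 0)) (height C + 1) - f (level_count k C) (height C)) \<le> g C"
  shows "0 \<le> f 0 0 + occupation n g"
proof -
  have "0 \<le> (\<integral>C. f (level_count k C) (height C) \<partial>dla_final n)"
    using assms(2) by (intro Bochner_Integration.integral_nonneg) auto
  also have "\<dots> \<le> f 0 0 + occupation n g" using assms(1,3) by (rule occupation_test)
  finally show ?thesis .
qed

abbreviation rlevel :: "nat \<Rightarrow> nat set set \<Rightarrow> real" where
  "rlevel k C \<equiv> real (level_count k C)"

text \<open>The test function \<open>of_bool (h \<le> l)\<close> drops from 1 to 0 at most once, and
  each step at height l makes it drop with probability m(l) / c(l). It ignores the level count, so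
  \<open>k = 1\<close> is an arbitrary choice.\<close>

lemma occupation_height_eq:
  assumes "l \<le> n"
  shows "occupation n (\<lambda>C. of_bool (height C = l) * rlevel l C) \<le> real (n choose l)"
proof -
  have c: "real (n choose l) > 0" using assms by simp
  have "0 \<le> of_bool (0 \<le> l) +
      occupation n (\<lambda>C. (- 1 / real (n choose l)) * (of_bool (height C = l) * rlevel l C))"
    by (rule occupation_test_nonneg[where k = 1 and f = "\<lambda>m h. of_bool (h \<le> l)"]) auto
  then show ?thesis unfolding occupation_cmult using c by (simp add: field_simps)
qed

text \<open>The test function is m(k) while the height is k. Leaving height k destroys m(k) with
  probability m(k) / c(k), hence the square. Gains come at rate at most m(k - 1) / c(k - 1); the
  arrival from height k - 1 brings a single vertex and costs at most 1 by
  \<open>occupation_height_eq\<close>.\<close>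

lemma occupation_height_eq_square:
  assumes k: "0 < k" "k \<le> n"
  shows "occupation n (\<lambda>C. of_bool (height C = k) * (rlevel k C)\<^sup>2) / real (n choose k)
    \<le> 1 + occupation n (\<lambda>C. of_bool (height C = k) * rlevel (k - 1) C) / real (n choose (k - 1))"
proof -
  let ?c = "real (n choose k)" and ?d = "real (n choose (k - 1))"
  have c: "?c > 0" and d: "?d > 0" using k by simp_all
  have "0 \<le> of_bool (0 = k) * real 0 +
      occupation n (\<lambda>C. (- 1 / ?c) * (of_bool (height C = k) * (rlevel k C)\<^sup>2) +
       ((1 / ?d) * (of_bool (height C = k) * rlevel (k - 1) C)
        + (1 / ?d) * (of_bool (height C = k - 1) * rlevel (k - 1) C)))"
  proof (rule occupation_test_nonneg[OF k(1), where f = "\<lambda>m h. of_bool (h = k) * real m"], goal_cases)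
    case (2 C q)
    have nk: "k \<noteq> k - Suc 0" using k by simp
    consider "height C = k" | "height C = k - 1" | "height C \<noteq> k" "height C + 1 \<noteq> k" by linarith
    then show ?case
    proof cases
      case 1
      then show ?thesis using 2 k nk by (simp add: power2_eq_square)
    next
      case 2
      then show ?thesis using k level_count_zero[OF \<open>valid_cluster n C\<close>, of k] by simp
    next
      case 3
      then show ?thesis using k by auto
    qed
  qed simp
  then have "occupation n (\<lambda>C. of_bool (height C = k) * (rlevel k C)\<^sup>2) / ?c
      \<le> occupation n (\<lambda>C. of_bool (height C = k) * rlevel (k - 1) C) / ?d + occupation n (\<lambda>C. of_bool (height C = k - 1) * rlevel (k - 1) C) / ?d"
    using k unfolding occupation_add occupation_cmult by simp
  moreover have "occupation n (\<lambda>C. of_bool (height C = k - 1) * rlevel (k - 1) C) / ?d \<le> 1"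
    using occupation_height_eq[of "k - 1" n] k d by simp
  ultimately show ?thesis by linarith
qed

text \<open>The saving: only \<open>q \<le> 1\<close> is used for the growth of level k. The test
  function m(k) squared, at height k, loses m(k) cubed / c(k) and gains at most 2 m(k) + 1 \<le> 3
  m(k) per step, so the cubic moment is at most 4 c(k) squared. Interpolating with the linear
  moment, at most c(k), bounds the quadratic one.\<close>

lemma occupation_height_eq_square_sqrt:
  assumes k: "0 < k" "k \<le> n"
  shows "occupation n (\<lambda>C. of_bool (height C = k) * (rlevel k C)\<^sup>2) / real (n choose k) \<le> 2 * sqrt (real (n choose k))"
proof -
  let ?c = "real (n choose k)" and ?d = "real (n choose (k - 1))"
  have "0 < n choose k" using k by simp
  then have c: "?c \<ge> 1" by linarith
  have d: "?d > 0" using k by simp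
  have "0 \<le> of_bool (0 = k) * (real 0)\<^sup>2 +
      occupation n (\<lambda>C. (- 1 / ?c) * (of_bool (height C = k) * (rlevel k C) ^ 3) +
       (3 * (of_bool (height C = k) * rlevel k C)
        + (1 / ?d) * (of_bool (height C = k - 1) * rlevel (k - 1) C)))"
  proof (rule occupation_test_nonneg[OF k(1), where f = "\<lambda>m h. of_bool (h = k) * (real m)\<^sup>2"], goal_cases)
    case (2 C q)
    have nk: "k \<noteq> k - Suc 0" using k by simp
    consider "height C = k" | "height C = k - 1" | "height C \<noteq> k" "height C + 1 \<noteq> k" by linarith
    then show ?case
    proof cases
      case 1
      have "1 \<le> rlevel k C" using level_count_pos[OF \<open>valid_cluster n C\<close>, of k] 1 by simp
      moreover have "q * (2 * rlevel k C + 1) \<le> 1 * (2 * rlevel k C + 1)"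
        using \<open>q \<le> 1\<close> by (intro mult_right_mono) auto
      ultimately have "q * ((rlevel k C + 1)\<^sup>2 - (rlevel k C)\<^sup>2) \<le> 3 * rlevel k C"
        by (simp add: power2_eq_square algebra_simps)
      then show ?thesis using 1 nk by (simp add: power3_eq_cube power2_eq_square add.commute)
    next
      case 2
      then show ?thesis using k level_count_zero[OF \<open>valid_cluster n C\<close>, of k] by simp
    next
      case 3
      then show ?thesis using k by auto
    qed
  qed simp
  then have "occupation n (\<lambda>C. of_bool (height C = k) * (rlevel k C) ^ 3) / ?c
      \<le> 3 * occupation n (\<lambda>C. of_bool (height C = k) * rlevel k C) + occupation n (\<lambda>C. of_bool (height C = k - 1) * rlevel (k - 1) C) / ?d"
    using k unfolding occupation_add occupation_cmult by simp
  moreover have "occupation n (\<lambda>C. of_bool (height C = k - 1) * rlevel (k - 1) C) / ?d \<le> 1"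
    using occupation_height_eq[of "k - 1" n] k d by simp
  moreover have lin: "occupation n (\<lambda>C. of_bool (height C = k) * rlevel k C) \<le> ?c"
    using occupation_height_eq[of k n] k by simp
  ultimately have "occupation n (\<lambda>C. of_bool (height C = k) * (rlevel k C) ^ 3) / ?c \<le> 4 * ?c"
    using c by linarith
  then have cub: "occupation n (\<lambda>C. of_bool (height C = k) * (rlevel k C) ^ 3) \<le> 4 * ?c\<^sup>2"
    using k by (simp add: pos_divide_le_eq power2_eq_square mult_ac)
  define s where "s = sqrt ?c"
  have s: "s > 0" "?c = s\<^sup>2" using k c by (auto simp: s_def)
  have "occupation n (\<lambda>C. of_bool (height C = k) * (rlevel k C)\<^sup>2) \<le>
      occupation n (\<lambda>C. (1 / (4 * s)) * (of_bool (height C = k) * (rlevel k C) ^ 3)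
        + s * (of_bool (height C = k) * rlevel k C))"
  proof (rule occupation_mono)
    fix C
    \<comment> \<open>AM-GM, balanced so that the cubic and the linear contribution coincide\<close>
    have "0 \<le> rlevel k C * (rlevel k C - 2 * s)\<^sup>2" by simp
    then have "rlevel k C ^ 2 * (4 * s) \<le> rlevel k C ^ 3 + 4 * s\<^sup>2 * rlevel k C"
      by (simp add: power2_eq_square power3_eq_cube algebra_simps)
    then have "(rlevel k C)\<^sup>2 \<le> (1 / (4 * s)) * rlevel k C ^ 3 + s * rlevel k C"
      using s by (simp add: field_simps power2_eq_square)
    then show "of_bool (height C = k) * (rlevel k C)\<^sup>2 \<le>
      (1 / (4 * s)) * (of_bool (height C = k) * (rlevel k C) ^ 3) + s * (of_bool (height C = k) * rlevel k C)"
      by simp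
  qed
  also have "\<dots> \<le> (1 / (4 * s)) * (4 * ?c\<^sup>2) + s * ?c"
    unfolding occupation_add occupation_cmult using s cub lin by (intro add_mono mult_left_mono) auto
  also have "\<dots> = 2 * s * ?c" using s by (simp add: power2_eq_square)
  finally show ?thesis using k unfolding s_def by (simp add: pos_divide_le_eq mult_ac)
qed

text \<open>From height l on, the expected remaining time is at most the tail weight of l, since height i is left
with probability at least 1 / (n choose i) in each step.\<close>
definition tail_weight :: "nat \<Rightarrow> nat \<Rightarrow> real" where
  "tail_weight n l = (\<Sum>i=l..<n. real (n choose i))"

lemma tail_weight_rec: "l < n \<Longrightarrow> tail_weight n l = real (n choose l) + tail_weight n (Suc l)"
  unfolding tail_weight_def by (rule sum.atLeast_Suc_lessThan)

lemma tail_weight_antimono: "l \<le> l' \<Longrightarrow> tail_weight n l' \<le> tail_weight n l"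
  unfolding tail_weight_def by (intro sum_mono2) auto

lemma tail_weight_nonneg: "0 \<le> tail_weight n l"
  unfolding tail_weight_def by (intro sum_nonneg) auto

text \<open>The test function weights the m(k) vertices, once the height exceeds k, by the bound
  \<open>tail_weight n (max h l)\<close> on the time still to be spent at heights at least l. It is
  fed on leaving height k, by m(k) vertices with probability m(k) / c(k), and later by new vertices
  of level k; each vertex is worth at most \<open>tail_weight n l\<close>.\<close>

lemma occupation_height_ge:
  assumes k: "0 < k" "k \<le> n" and l: "k < l"
  shows "occupation n (\<lambda>C. of_bool (l \<le> height C) * rlevel k C) \<le> tail_weight n l *
    (occupation n (\<lambda>C. of_bool (height C = k) * (rlevel k C)\<^sup>2) / real (n choose k)
     + occupation n (\<lambda>C. of_bool (k < height C) * rlevel (k - 1) C) / real (n choose (k - 1)))"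
proof -
  let ?c = "real (n choose k)" and ?d = "real (n choose (k - 1))"
  have c: "?c > 0" and d: "?d > 0" using k by simp_all
  have "0 \<le> of_bool (k < 0) * real 0 * tail_weight n (max 0 l) +
      occupation n (\<lambda>C. (- 1) * (of_bool (l \<le> height C) * rlevel k C) +
       ((tail_weight n l / ?c) * (of_bool (height C = k) * (rlevel k C)\<^sup>2)
        + (tail_weight n l / ?d) * (of_bool (k < height C) * rlevel (k - 1) C)))"
  proof (rule occupation_test_nonneg[OF k(1), where f = "\<lambda>m h. of_bool (k < h) * real m * tail_weight n (max h l)"], goal_cases)
    case (2 C q)
    consider "height C < k" | "height C = k" | "k < height C" "height C < l" | "l \<le> height C" by linarith
    then show ?case
    proof cases
      case 1
      then show ?thesis using l by auto
    next
      case 2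
      have "max (height C + 1) l = l" using 2 l by simp
      then show ?thesis using 2 l by (simp add: power2_eq_square mult_ac)
    next
      case 3
      have "max (height C + 1) l = l" "max (height C) l = l" using 3 by simp_all
      moreover have "q * tail_weight n l \<le> rlevel (k - 1) C / ?d * tail_weight n l"
        using 2 by (intro mult_right_mono tail_weight_nonneg) auto
      ultimately show ?thesis using 3 by (simp add: algebra_simps)
    next
      case 4
      have "max (height C + 1) l = height C + 1" "max (height C) l = height C" using 4 by simp_all
      moreover have "q * tail_weight n (height C) \<le> rlevel (k - 1) C / ?d * tail_weight n l"
        using 2 4 by (intro mult_mono tail_weight_nonneg tail_weight_antimono) auto
      then have "q * tail_weight n (height C) \<le> tail_weight n l * rlevel (k - 1) C / ?d" by (simp add: mult_ac)
      \<comment> \<open>A rise from height h lowers the tail weight by exactly c(h) and has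
        probability m(h) / c(h) with m(h) \<ge> 1, so the drift pays for at least m(k).\<close>
      moreover have "1 * rlevel k C \<le> rlevel (height C) C * rlevel k C"
        using level_count_pos[OF \<open>valid_cluster n C\<close>, of "height C"] by (intro mult_right_mono) auto
      moreover have "(1 + rlevel k C) * tail_weight n (height C) - rlevel k C * tail_weight n (height C) = tail_weight n (height C)"
        by (simp add: algebra_simps)
      moreover have "rlevel (height C) C / real (n choose height C) *
          (rlevel k C * tail_weight n (height C + 1) - rlevel k C * tail_weight n (height C)) = - (rlevel (height C) C * rlevel k C)"
        using tail_weight_rec[of "height C" n] \<open>height C < n\<close> by (simp add: field_simps)
      ultimately show ?thesis using 4 l by simp
    qed
  qed (simp add: tail_weight_nonneg)
  then show ?thesis unfolding occupation_add occupation_cmult by (simp add: algebra_simps)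
qed

text \<open>The first vertex of level k arrives from height k - 1 and accounts for the 1; all others
  arrive when the height is already at least k.\<close>

lemma expectation_level_count_le:
  assumes k: "0 < k" "k \<le> n"
  shows "(\<integral>C. rlevel k C \<partial>dla_final n) \<le>
    1 + occupation n (\<lambda>C. of_bool (k \<le> height C) * rlevel (k - 1) C) / real (n choose (k - 1))"
proof -
  let ?d = "real (n choose (k - 1))"
  have d: "?d > 0" using k by simp
  have "(\<integral>C. rlevel k C \<partial>dla_final n) \<le> real 0 +
      occupation n (\<lambda>C. (1 / ?d) * (of_bool (height C = k - 1) * rlevel (k - 1) C) +
       (1 / ?d) * (of_bool (k \<le> height C) * rlevel (k - 1) C))"
  proof (rule occupation_test[OF k(1), where f = "\<lambda>m h. real m"], goal_cases)
    case (1 C q)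
    consider "k \<le> height C" | "height C = k - 1" | "height C + 1 < k" by linarith
    then show ?case
    proof cases
      case 1
      then show ?thesis using \<open>q \<le> _ / _\<close> k by auto
    next
      case 2
      then show ?thesis using k by auto
    qed auto
  qed
  then have "(\<integral>C. rlevel k C \<partial>dla_final n) \<le>
      occupation n (\<lambda>C. of_bool (height C = k - 1) * rlevel (k - 1) C) / ?d + occupation n (\<lambda>C. of_bool (k \<le> height C) * rlevel (k - 1) C) / ?d"
    unfolding occupation_add occupation_cmult by simp
  moreover have "occupation n (\<lambda>C. of_bool (height C = k - 1) * rlevel (k - 1) C) / ?d \<le> 1"
    using occupation_height_eq[of "k - 1" n] k d by simp
  ultimately show ?thesis by linarith
qed

section \<open>Recursions between consecutive levels\<close>

text \<open>This is W(k) of the overview.\<close>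

definition above_occ :: "nat \<Rightarrow> nat \<Rightarrow> real" where
  "above_occ n k = occupation n (\<lambda>C. of_bool (k < height C) * rlevel k C)"

text \<open>Restricting to heights at least k + 2, instead of k + 1, is what gains the second factor \<rho> in the
recursion.\<close>
definition far_above_occ :: "nat \<Rightarrow> nat \<Rightarrow> real" where
  "far_above_occ n k = occupation n (\<lambda>C. of_bool (k + 2 \<le> height C) * rlevel k C)"

lemma above_occ_nonneg: "0 \<le> above_occ n k"
  unfolding above_occ_def by (intro occupation_nonneg) simp

lemma far_above_occ_nonneg: "0 \<le> far_above_occ n k"
  unfolding far_above_occ_def by (intro occupation_nonneg) simp

text \<open>\<open>above_occ n k\<close> splits into the steps at height k + 1, which pay for the
  square term of \<open>occupation_height_ge\<close>, and those at greater heights, which pay for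
  its growth term; together they use it exactly once.\<close>

lemma above_occ_rec:
  assumes "Suc k \<le> n"
  shows "above_occ n (Suc k) \<le> tail_weight n (k + 2) * (1 + above_occ n k / real (n choose k))"
proof -
  let ?d = "real (n choose k)"
  let ?S = "occupation n (\<lambda>C. of_bool (height C = Suc k) * (rlevel (Suc k) C)\<^sup>2) / real (n choose Suc k)"
  let ?E = "occupation n (\<lambda>C. of_bool (height C = Suc k) * rlevel k C)"
  let ?G = "occupation n (\<lambda>C. of_bool (Suc k < height C) * rlevel k C)"
  have "above_occ n k = occupation n (\<lambda>C. of_bool (height C = Suc k) * rlevel k C + of_bool (Suc k < height C) * rlevel k C)"
    unfolding above_occ_def by (intro arg_cong[of _ _ "occupation n"] ext) auto
  then have W: "above_occ n k / ?d = ?E / ?d + ?G / ?d" by (simp add: occupation_add add_divide_distrib)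
  have "?S \<le> 1 + ?E / ?d" using occupation_height_eq_square[of "Suc k" n] assms by simp
  then have "?S + ?G / ?d \<le> 1 + above_occ n k / ?d" using W by linarith
  then have "tail_weight n (k + 2) * (?S + ?G / ?d) \<le> tail_weight n (k + 2) * (1 + above_occ n k / ?d)"
    by (intro mult_left_mono tail_weight_nonneg)
  moreover have "above_occ n (Suc k) \<le> tail_weight n (k + 2) * (?S + ?G / ?d)"
    using occupation_height_ge[of "Suc k" n "k + 2"] assms by (simp add: above_occ_def Suc_le_eq)
  ultimately show ?thesis by linarith
qed

text \<open>With the square term bounded by a square root, only the steps at heights at least k + 2
  remain. Taking l as k + 2 or k + 3 gives the recursions for \<open>above_occ\<close> and
  \<open>far_above_occ\<close>.\<close>

lemma occupation_sqrt_rec: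
  assumes "Suc k \<le> n" "k + 2 \<le> l"
  shows "occupation n (\<lambda>C. of_bool (l \<le> height C) * rlevel (Suc k) C) \<le>
    tail_weight n l * (2 * sqrt (real (n choose Suc k)) + far_above_occ n k / real (n choose k))"
proof -
  let ?S = "occupation n (\<lambda>C. of_bool (height C = Suc k) * (rlevel (Suc k) C)\<^sup>2) / real (n choose Suc k)"
  have "?S \<le> 2 * sqrt (real (n choose Suc k))"
    using occupation_height_eq_square_sqrt[of "Suc k" n] assms by simp
  then have "tail_weight n l * (?S + far_above_occ n k / real (n choose k))
      \<le> tail_weight n l * (2 * sqrt (real (n choose Suc k)) + far_above_occ n k / real (n choose k))"
    by (intro mult_left_mono tail_weight_nonneg) simp
  moreover have "occupation n (\<lambda>C. of_bool (l \<le> height C) * rlevel (Suc k) C)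
      \<le> tail_weight n l * (?S + far_above_occ n k / real (n choose k))"
    using occupation_height_ge[of "Suc k" n l] assms by (simp add: far_above_occ_def Suc_le_eq)
  ultimately show ?thesis by linarith
qed

lemma above_occ_sqrt_rec:
  assumes "Suc k \<le> n"
  shows "above_occ n (Suc k) \<le>
    tail_weight n (k + 2) * (2 * sqrt (real (n choose Suc k)) + far_above_occ n k / real (n choose k))"
  using occupation_sqrt_rec[OF assms, of "k + 2"] by (simp add: above_occ_def Suc_le_eq)

lemma far_above_occ_sqrt_rec:
  assumes "Suc k \<le> n"
  shows "far_above_occ n (Suc k) \<le>
    tail_weight n (k + 3) * (2 * sqrt (real (n choose Suc k)) + far_above_occ n k / real (n choose k))"
  using occupation_sqrt_rec[OF assms, of "k + 3"] by (simp add: far_above_occ_def numeral_eq_Suc)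

text \<open>The starting point of the recursion: m(k) \<le> c(k), and the expected time at height i
  is at most c(i) because m(i) \<ge> 1 there.\<close>

lemma far_above_occ_le:
  "far_above_occ n k \<le> real (n choose k) * tail_weight n (k + 2)"
proof -
  let ?I = "{k + 2..<n}"
  have "far_above_occ n k \<le> occupation n (\<lambda>C. real (n choose k) * (\<Sum>i\<in>?I. of_bool (height C = i) * rlevel i C))"
    unfolding far_above_occ_def
  proof (rule occupation_mono)
    fix C assume C: "valid_cluster n C" "height C < n"
    show "of_bool (k + 2 \<le> height C) * rlevel k C
        \<le> real (n choose k) * (\<Sum>i\<in>?I. of_bool (height C = i) * rlevel i C)"
    proof (cases "k + 2 \<le> height C")
      case True
      have "1 \<le> of_bool (height C = height C) * rlevel (height C) C" using level_count_pos[OF C(1), of "height C"] by simp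
      also have "\<dots> \<le> (\<Sum>i\<in>?I. of_bool (height C = i) * rlevel i C)"
        using True C by (intro member_le_sum) auto
      finally have "real (n choose k) * 1 \<le> real (n choose k) * (\<Sum>i\<in>?I. of_bool (height C = i) * rlevel i C)"
        by (intro mult_left_mono) auto
      then show ?thesis using True level_count_le_binomial[OF C(1), of k] by simp
    next
      case False
      then show ?thesis by (simp add: sum_nonneg)
    qed
  qed
  also have "\<dots> = real (n choose k) * (\<Sum>i\<in>?I. occupation n (\<lambda>C. of_bool (height C = i) * rlevel i C))"
    by (simp only: occupation_cmult occupation_sum)
  also have "\<dots> \<le> real (n choose k) * tail_weight n (k + 2)"
    unfolding tail_weight_def by (intro mult_left_mono sum_mono occupation_height_eq) auto
  finally show ?thesis .
qed

section \<open>Elementary binomial estimates\<close>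

lemma divide_le_if_le_mult:
  fixes c :: real
  assumes "0 < c" "x \<le> (a * c) * y"
  shows "x / c \<le> a * y"
  using assms by (simp add: pos_divide_le_eq mult_ac)

text \<open>A crude Stirling bound by induction, from (1 + 1 / s) ^ s \<le> e \<le> 3.\<close>

lemma power_self_le_fact: "real s ^ s \<le> 3 ^ s * fact s"
proof (induction s)
  case (Suc s)
  have "real (Suc s) ^ s \<le> 3 * real s ^ s"
  proof (cases "s = 0")
    case False
    have "(1 + 1 / real s) ^ s \<le> exp 1"
      using exp_ge_one_plus_x_over_n_power_n[of s 1] False by simp
    also have "\<dots> \<le> 3" by (rule exp_le)
    finally have "(1 + 1 / real s) ^ s * real s ^ s \<le> 3 * real s ^ s"
      by (intro mult_right_mono) auto
    moreover have "(1 + 1 / real s) ^ s * real s ^ s = real (Suc s) ^ s"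
      using False by (simp add: power_mult_distrib[symmetric] field_simps)
    ultimately show ?thesis by simp
  qed simp
  also have "\<dots> \<le> 3 * (3 ^ s * fact s)" using Suc by simp
  finally have "real (Suc s) * real (Suc s) ^ s \<le> real (Suc s) * (3 * (3 ^ s * fact s))"
    by (intro mult_left_mono) auto
  then show ?case by (simp add: mult_ac)
qed simp

lemma binomial_le_power:
  assumes "0 < s"
  shows "real (n choose s) \<le> (3 * real n / real s) ^ s"
proof -
  have "real (n choose s) * real s ^ s \<le> real (n choose s) * (3 ^ s * fact s)"
    by (intro mult_left_mono power_self_le_fact) auto
  also have "\<dots> = 3 ^ s * real ((n choose s) * fact s)" by simp
  also have "\<dots> \<le> 3 ^ s * real (n ^ s)"
    by (intro mult_left_mono of_nat_mono binomial_fact_pow) auto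
  finally show ?thesis using assms by (simp add: power_divide power_mult_distrib pos_le_divide_eq)
qed

lemma binomial_Suc_ratio: "real (Suc i) * real (n choose Suc i) = real (n - i) * real (n choose i)"
proof -
  have "Suc i * (n choose Suc i) = (n - i) * (n choose i)"
    using binomial_absorption[of i n] binomial_absorb_comp[of n i] by simp
  then show ?thesis by (metis of_nat_mult)
qed

section \<open>Solving the recursions on the top levels\<close>

text \<open>The constant 5971968 is 2 ^ 7 * 6 ^ 6: it arises from 7 A steps of the simple recursion, contracting
by 2 \<rho> each, against the initial value (6 / \<rho>) ^ (6 A).\<close>

context
  fixes n A :: nat and \<rho> :: real
  assumes A: "0 < A" and \<rho>: "\<rho> = 24 * real A / real n" and small: "5971968 * \<rho> \<le> 1" and n: "0 < n"
begin

lemma rho_pos: "0 < \<rho>" using A n \<rho> by simp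

lemma twentyfour_A_le: "24 * A \<le> n"
proof -
  have "\<rho> \<le> 1" using small rho_pos by simp
  then have "real (24 * A) \<le> real n" using \<rho> n by (simp add: field_simps)
  then show ?thesis by linarith
qed

text \<open>The ratio is (n - i) / (i + 1), with numerator at most 12 A and denominator at least n /
  2; this explains the 24 in \<rho>.\<close>

lemma binomial_ratio:
  assumes "n - 12 * A \<le> i"
  shows "real (n choose Suc i) \<le> \<rho> * real (n choose i)"
proof -
  have "n \<le> 2 * Suc i" "n - i \<le> 12 * A" using twentyfour_A_le assms by auto
  then have "real n \<le> real (2 * Suc i)" "real (n - i) \<le> real (12 * A)" by (simp_all only: of_nat_le_iff)
  then have i: "real n \<le> 2 * real (Suc i)" "real (n - i) \<le> 12 * real A" by simp_all
  have "real n * real (n choose Suc i) \<le> 2 * real (Suc i) * real (n choose Suc i)"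
    using i by (intro mult_right_mono) auto
  also have "\<dots> = 2 * (real (n - i) * real (n choose i))"
    by (simp only: mult.assoc binomial_Suc_ratio)
  also have "\<dots> \<le> 2 * (12 * real A * real (n choose i))"
    using i by (intro mult_left_mono mult_right_mono) auto
  finally show ?thesis using n by (simp add: \<rho> field_simps)
qed

text \<open>Geometric decay with ratio \<rho> \<le> 1/2, by induction downwards from the top
  level.\<close>

lemma tail_weight_le:
  assumes "n - 12 * A \<le> i"
  shows "tail_weight n i \<le> 2 * real (n choose i)"
  using assms
proof (induction "n - i" arbitrary: i)
  case 0
  then show ?case by (simp add: tail_weight_def)
next
  case (Suc d)
  have "tail_weight n (Suc i) \<le> 2 * real (n choose Suc i)" using Suc by (intro Suc.hyps) auto
  also have "\<dots> \<le> 2 * (\<rho> * real (n choose i))" using binomial_ratio[of i] Suc by simp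
  also have "\<dots> \<le> 1 * real (n choose i)"
    using small unfolding mult.assoc[symmetric] by (intro mult_right_mono) auto
  finally show ?case using tail_weight_rec[of i n] Suc by simp
qed

lemma tail_weight_Suc_le:
  assumes "n - 12 * A \<le> i"
  shows "tail_weight n (i + 1) \<le> 2 * \<rho> * real (n choose i)"
  using tail_weight_le[of "i + 1"] binomial_ratio[OF assms] assms by simp

lemma tail_weight_Suc_Suc_le:
  assumes "n - 12 * A \<le> i"
  shows "tail_weight n (i + 2) \<le> 2 * \<rho>\<^sup>2 * real (n choose i)"
proof -
  have "tail_weight n (i + 2) \<le> 2 * \<rho> * real (n choose Suc i)" using tail_weight_Suc_le[of "Suc i"] assms by simp
  also have "\<dots> \<le> 2 * \<rho> * (\<rho> * real (n choose i))"
    using binomial_ratio[OF assms] rho_pos by (intro mult_left_mono) auto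
  finally show ?thesis by (simp add: power2_eq_square)
qed

text \<open>The top 12 A levels serve three purposes: 4 A to contract from \<open>c0\<close> to
  \<open>sqrt c0\<close>, 7 A for the simple recursion, and the last A where the bound is
  wanted.\<close>

abbreviation "k0 \<equiv> n - 12 * A"
abbreviation "c0 \<equiv> real (n choose k0)"

lemma binomial_le_c0: "real (n choose (k0 + s)) \<le> c0"
proof (induction s)
  case (Suc s)
  have "real (n choose (k0 + Suc s)) \<le> \<rho> * real (n choose (k0 + s))"
    using binomial_ratio[of "k0 + s"] by simp
  also have "\<dots> \<le> 1 * real (n choose (k0 + s))" using small by (intro mult_right_mono) auto
  finally show ?case using Suc by simp
qed simp

lemma sqrt_c0_le: "sqrt c0 \<le> (6 / \<rho>) ^ (6 * A)"
proof (rule real_le_lsqrt)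
  have "n choose k0 = n choose (12 * A)" using twentyfour_A_le by (intro binomial_symmetric[symmetric]) simp
  then have "c0 \<le> (3 * real n / real (12 * A)) ^ (12 * A)"
    using binomial_le_power[of "12 * A" n] A by simp
  also have "3 * real n / real (12 * A) = 6 / \<rho>" using A n by (simp add: \<rho> field_simps)
  finally show "c0 \<le> ((6 / \<rho>) ^ (6 * A))\<^sup>2" by (simp add: power_mult[symmetric] mult_ac)
qed (use rho_pos in auto)

lemma rho_sq: "6 * \<rho>\<^sup>2 \<le> 1"
proof -
  have "\<rho> * \<rho> \<le> 1 * \<rho>" using small rho_pos by (intro mult_right_mono) auto
  then show ?thesis using small rho_pos unfolding power2_eq_square by linarith
qed

text \<open>The starting value contracts by 2 \<rho>^2 per level, while \<open>sqrt c0\<close>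
  absorbs the inhomogeneous term because three times 2 \<rho>^2 is at most 1.\<close>

lemma far_above_occ_decay:
  assumes "k0 + s \<le> n"
  shows "far_above_occ n (k0 + s) / real (n choose (k0 + s)) \<le> sqrt c0 + (2 * \<rho>\<^sup>2) ^ s * c0"
  using assms
proof (induction s)
  case 0
  have "far_above_occ n k0 / c0 \<le> tail_weight n (k0 + 2)"
    using far_above_occ_le[of n k0] by (simp add: divide_le_eq mult_ac)
  also have "\<dots> \<le> 2 * \<rho>\<^sup>2 * c0" by (rule tail_weight_Suc_Suc_le) simp
  also have "\<dots> \<le> 1 * c0" using rho_sq by (intro mult_right_mono) auto
  finally show ?case by (simp add: add_increasing)
next
  case (Suc s)
  let ?k = "k0 + s"
  let ?c = "real (n choose Suc ?k)"
  have c: "?c > 0" using Suc.prems by simp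
  have "far_above_occ n (Suc ?k) \<le> tail_weight n (?k + 3) * (2 * sqrt ?c + far_above_occ n ?k / real (n choose ?k))"
    by (rule far_above_occ_sqrt_rec) (use Suc.prems in simp)
  also have "\<dots> \<le> (2 * \<rho>\<^sup>2 * ?c) * (2 * sqrt c0 + (sqrt c0 + (2 * \<rho>\<^sup>2) ^ s * c0))"
  proof (intro mult_mono add_mono)
    show "tail_weight n (?k + 3) \<le> 2 * \<rho>\<^sup>2 * ?c" using tail_weight_Suc_Suc_le[of "Suc ?k"] by (simp add: numeral_eq_Suc)
    show "sqrt ?c \<le> sqrt c0" using binomial_le_c0[of "Suc s"] by simp
    show "far_above_occ n ?k / real (n choose ?k) \<le> sqrt c0 + (2 * \<rho>\<^sup>2) ^ s * c0"
      using Suc by simp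
  qed (auto simp: far_above_occ_nonneg)
  finally have "far_above_occ n (Suc ?k) / ?c \<le> 2 * \<rho>\<^sup>2 * (2 * sqrt c0 + (sqrt c0 + (2 * \<rho>\<^sup>2) ^ s * c0))"
    by (rule divide_le_if_le_mult[OF c])
  also have "\<dots> = (6 * \<rho>\<^sup>2) * sqrt c0 + (2 * \<rho>\<^sup>2) ^ Suc s * c0" by (simp add: algebra_simps)
  also have "\<dots> \<le> 1 * sqrt c0 + (2 * \<rho>\<^sup>2) ^ Suc s * c0"
    using rho_sq by (intro add_right_mono mult_right_mono) auto
  finally show ?case by simp
qed

text \<open>The 4 A contractions gain 8 A powers of \<rho>, whereas \<open>sqrt c0\<close> costs
  only 6 A of them. The constant 746496 is 2 ^ 4 * 6 ^ 6.\<close>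

lemma far_above_occ_sqrt_bound:
  "far_above_occ n (k0 + 4 * A) / real (n choose (k0 + 4 * A)) \<le> 2 * sqrt c0"
proof -
  have "(2 * \<rho>\<^sup>2) ^ (4 * A) * sqrt c0 \<le> (2 * \<rho>\<^sup>2) ^ (4 * A) * (6 / \<rho>) ^ (6 * A)"
    by (intro mult_left_mono sqrt_c0_le) auto
  also have "\<dots> = ((2 * \<rho>\<^sup>2) ^ 4 * (6 / \<rho>) ^ 6) ^ A"
    by (simp only: power_mult power_mult_distrib)
  also have "(2 * \<rho>\<^sup>2) ^ 4 * (6 / \<rho>) ^ 6 = 746496 * \<rho>\<^sup>2"
    using rho_pos by (simp add: power_divide power_mult_distrib field_simps flip: power_add power_mult)
  also have "(746496 * \<rho>\<^sup>2) ^ A \<le> 1"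
  proof (rule power_le_one)
    have "746496 * \<rho> * \<rho> \<le> 1 * 1" using small rho_pos by (intro mult_mono) auto
    then show "746496 * \<rho>\<^sup>2 \<le> 1" by (simp add: power2_eq_square)
  qed simp
  finally have "(2 * \<rho>\<^sup>2) ^ (4 * A) * sqrt c0 * sqrt c0 \<le> 1 * sqrt c0"
    by (intro mult_right_mono) auto
  then have "(2 * \<rho>\<^sup>2) ^ (4 * A) * c0 \<le> sqrt c0" by (simp add: mult.assoc)
  moreover have "k0 + 4 * A \<le> n" using twentyfour_A_le by simp
  ultimately show ?thesis using far_above_occ_decay[of "4 * A"] by linarith
qed

abbreviation "k1 \<equiv> Suc (k0 + 4 * A)"

text \<open>The square root recursion is used once, to start at \<open>k1\<close> with at most 8
  \<rho> \<open>sqrt c0\<close>; from there the simple recursion contracts by 2 \<rho>. The summand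
  4 \<rho> reproduces itself, since 2 \<rho> (1 + 4 \<rho>) \<le> 4 \<rho>.\<close>

lemma above_occ_decay:
  assumes "k1 + s \<le> n"
  shows "above_occ n (k1 + s) / real (n choose (k1 + s)) \<le> 4 * \<rho> + (2 * \<rho>) ^ s * sqrt c0"
  using assms
proof (induction s)
  case 0
  let ?c = "real (n choose k1)"
  have c: "?c > 0" using 0 by simp
  have "above_occ n k1 \<le> tail_weight n (k0 + 4 * A + 2) *
      (2 * sqrt ?c + far_above_occ n (k0 + 4 * A) / real (n choose (k0 + 4 * A)))"
    by (rule above_occ_sqrt_rec) (use 0 in simp)
  also have "\<dots> \<le> (2 * \<rho> * ?c) * (2 * sqrt c0 + 2 * sqrt c0)"
  proof (intro mult_mono add_mono)
    show "tail_weight n (k0 + 4 * A + 2) \<le> 2 * \<rho> * ?c" using tail_weight_Suc_le[of k1] by simp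
    show "sqrt ?c \<le> sqrt c0" using binomial_le_c0[of "Suc (4 * A)"] by simp
    show "far_above_occ n (k0 + 4 * A) / real (n choose (k0 + 4 * A)) \<le> 2 * sqrt c0"
      by (rule far_above_occ_sqrt_bound)
  qed (use rho_pos in \<open>auto simp: far_above_occ_nonneg\<close>)
  finally have "above_occ n k1 / ?c \<le> 2 * \<rho> * (2 * sqrt c0 + 2 * sqrt c0)"
    by (rule divide_le_if_le_mult[OF c])
  also have "\<dots> = 8 * \<rho> * sqrt c0" by simp
  also have "\<dots> \<le> 1 * sqrt c0" using small by (intro mult_right_mono) auto
  finally show ?case using rho_pos by simp
next
  case (Suc s)
  let ?k = "k1 + s"
  let ?c = "real (n choose Suc ?k)"
  have c: "?c > 0" using Suc.prems by simp
  have "above_occ n (Suc ?k) \<le> tail_weight n (?k + 2) * (1 + above_occ n ?k / real (n choose ?k))"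
    by (rule above_occ_rec) (use Suc.prems in simp)
  also have "\<dots> \<le> (2 * \<rho> * ?c) * (1 + (4 * \<rho> + (2 * \<rho>) ^ s * sqrt c0))"
  proof (intro mult_mono add_mono)
    show "tail_weight n (?k + 2) \<le> 2 * \<rho> * ?c" using tail_weight_Suc_le[of "Suc ?k"] by simp
    show "above_occ n ?k / real (n choose ?k) \<le> 4 * \<rho> + (2 * \<rho>) ^ s * sqrt c0"
      using Suc by simp
  qed (use rho_pos in \<open>auto simp: above_occ_nonneg\<close>)
  finally have "above_occ n (Suc ?k) / ?c \<le> 2 * \<rho> * (1 + (4 * \<rho> + (2 * \<rho>) ^ s * sqrt c0))"
    by (rule divide_le_if_le_mult[OF c])
  also have "\<dots> = 2 * \<rho> * (1 + 4 * \<rho>) + (2 * \<rho>) ^ Suc s * sqrt c0" by (simp add: algebra_simps)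
  also have "2 * \<rho> * (1 + 4 * \<rho>) \<le> 2 * \<rho> * 2"
    using small rho_pos by (intro mult_left_mono) auto
  finally show ?case by simp
qed

text \<open>At least 7 A contractions by 2 \<rho> against 6 A lost powers leave a power A of 5971968
  \<rho>, of which one factor is kept. The constant is 5971968 + 4.\<close>

lemma above_occ_bound:
  assumes "n - A < k" "k \<le> n"
  shows "above_occ n k / real (n choose k) \<le> 5971972 * \<rho>"
proof -
  define s where "s = k - k1"
  have k: "k = k1 + s" and s: "7 * A \<le> s" using assms twentyfour_A_le by (auto simp: s_def)
  have "(2 * \<rho>) ^ s * sqrt c0 \<le> (2 * \<rho>) ^ (7 * A) * (6 / \<rho>) ^ (6 * A)"
    using small rho_pos s by (intro mult_mono power_decreasing sqrt_c0_le) auto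
  also have "\<dots> = ((2 * \<rho>) ^ 7 * (6 / \<rho>) ^ 6) ^ A"
    by (simp only: power_mult power_mult_distrib)
  also have "(2 * \<rho>) ^ 7 * (6 / \<rho>) ^ 6 = 5971968 * \<rho>"
    using rho_pos by (simp add: power_divide power_mult_distrib field_simps flip: power_Suc)
  also have "(5971968 * \<rho>) ^ A \<le> (5971968 * \<rho>) ^ 1"
    using small rho_pos A by (intro power_decreasing) auto
  finally show ?thesis using above_occ_decay[of s] k assms by simp
qed

end

section \<open>From expected sums to probabilities\<close>

lemma dla_final_valid_cluster:
  assumes "C \<in> set_pmf (dla_final n)"
  shows "valid_cluster n C" "height C = n"
proof -
  show v: "valid_cluster n C"
    using assms valid_cluster_dla_run[OF valid_cluster_init] unfolding dla_final_def by blast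
  have "{0..<n} \<in> C"
    using assms unfolding dla_final_def by (intro dla_run_terminates[OF valid_cluster_init, of n "2 ^ n"]) auto
  then have "card {0..<n} \<le> height C" by (rule valid_cluster_height(1)[OF v])
  then show "height C = n" using valid_cluster_height(2)[OF v] by simp
qed

text \<open>Markov's inequality for m(k) - 1, which is nonnegative since the final cluster meets
  every level; the subtracted 1 cancels the one in
  \<open>expectation_level_count_le\<close>.\<close>

lemma prob_level_count_ge_2:
  assumes k: "0 < k" "k \<le> n"
  shows "measure_pmf.prob (dla_final n) {C. 2 \<le> level_count k C} \<le> above_occ n (k - 1) / real (n choose (k - 1))"
proof -
  let ?P = "measure_pmf (dla_final n)"
  have int: "integrable ?P f" for f :: "_ \<Rightarrow> real"
    unfolding dla_final_def by (rule integrable_dla_run)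
  have "measure_pmf.prob (dla_final n) {C. 2 \<le> level_count k C} = (\<integral>C. indicator {C. 2 \<le> level_count k C} C \<partial>?P)"
    by simp
  also have "\<dots> \<le> (\<integral>C. rlevel k C - 1 \<partial>?P)"
  proof (rule integral_mono_AE[OF int int])
    have "1 \<le> level_count k C" if "C \<in> set_pmf (dla_final n)" for C
      using dla_final_valid_cluster[OF that] k by (intro level_count_pos) auto
    then show "AE C in ?P. indicator {C. 2 \<le> level_count k C} C \<le> rlevel k C - 1"
      by (force simp: AE_measure_pmf_iff indicator_def)
  qed
  also have "\<dots> = (\<integral>C. rlevel k C \<partial>?P) - 1"
    by (subst Bochner_Integration.integral_diff[OF int int]) simp
  also have "\<dots> \<le> occupation n (\<lambda>C. of_bool (k \<le> height C) * rlevel (k - 1) C) / real (n choose (k - 1))"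
    using expectation_level_count_le[OF k] by simp
  also have "(\<lambda>C. of_bool (k \<le> height C) * rlevel (k - 1) C) = (\<lambda>C. of_bool (k - 1 < height C) * rlevel (k - 1) C)"
    using k by (intro ext) auto
  finally show ?thesis by (simp only: above_occ_def)
qed

text \<open>A union bound over at most A levels. Level k is controlled through level k - 1, which
  must exceed n - A, hence the range from \<open>n - A + 2\<close>. The constant is 24 *
  5971972.\<close>

lemma prob_single_levels:
  assumes A: "2 \<le> A" and n: "0 < n" and small: "5971968 * (24 * real A / real n) \<le> 1"
  shows "1 - 143327328 * ((real A)\<^sup>2 / real n)
    \<le> measure_pmf.prob (dla_final n) {C. \<forall>k. n - A + 2 \<le> k \<and> k \<le> n \<longrightarrow> level_count k C = 1}"
    (is "_ \<le> measure_pmf.prob ?P ?G")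
proof -
  let ?\<rho> = "24 * real A / real n"
  let ?I = "{n - A + 2..n}"
  have "A \<le> n" using twentyfour_A_le[OF _ refl small n] A by simp
  have "measure_pmf.prob ?P (- ?G) \<le> measure_pmf.prob ?P (\<Union>k\<in>?I. {C. 2 \<le> level_count k C})"
  proof (rule measure_pmf.finite_measure_mono_AE)
    have "C \<in> (\<Union>k\<in>?I. {C. 2 \<le> level_count k C})" if "C \<in> set_pmf ?P" "C \<in> - ?G" for C
    proof -
      obtain k where k: "n - A + 2 \<le> k" "k \<le> n" "level_count k C \<noteq> 1" using \<open>C \<in> - ?G\<close> by auto
      moreover have "1 \<le> level_count k C" using dla_final_valid_cluster[OF that(1)] k by (intro level_count_pos) auto
      ultimately show ?thesis by (intro UN_I[of k]) auto
    qed
    then show "AE C in measure_pmf ?P. C \<in> - ?G \<longrightarrow> C \<in> (\<Union>k\<in>?I. {C. 2 \<le> level_count k C})"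
      by (simp add: AE_measure_pmf_iff)
  qed simp
  also have "\<dots> \<le> (\<Sum>k\<in>?I. measure_pmf.prob ?P {C. 2 \<le> level_count k C})"
    by (rule measure_pmf.finite_measure_subadditive_finite) auto
  also have "\<dots> \<le> (\<Sum>k\<in>?I. 5971972 * ?\<rho>)"
  proof (rule sum_mono)
    fix k assume k: "k \<in> ?I"
    have "measure_pmf.prob ?P {C. 2 \<le> level_count k C} \<le> above_occ n (k - 1) / real (n choose (k - 1))"
      using k by (intro prob_level_count_ge_2) auto
    also have "\<dots> \<le> 5971972 * ?\<rho>"
      using k A by (intro above_occ_bound[OF _ refl small n]) auto
    finally show "measure_pmf.prob ?P {C. 2 \<le> level_count k C} \<le> 5971972 * ?\<rho>" .
  qed
  also have "\<dots> = real (card ?I) * (5971972 * ?\<rho>)" by simp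
  also have "\<dots> \<le> real A * (5971972 * ?\<rho>)"
    using \<open>A \<le> n\<close> A by (intro mult_right_mono) auto
  also have "\<dots> = 143327328 * ((real A)\<^sup>2 / real n)" by (simp add: power2_eq_square)
  finally show ?thesis by (simp add: measure_pmf.prob_compl[of ?G, simplified] Compl_eq_Diff_UNIV)
qed

section \<open>Choice of A and passage to the limit\<close>

theorem theorem5:
  fixes a :: real
  assumes "a < 1/2"
  shows "(\<lambda>n. measure_pmf.prob (dla_final n)
            {C. \<forall>k::nat. real n - real n powr a \<le> real k \<and> k \<le> n \<longrightarrow>
                   card {x \<in> C. card x = k} = 1}) \<longlonglongrightarrow> 1"
proof -
  let ?G = "\<lambda>n. {C. \<forall>k::nat. real n - real n powr a \<le> real k \<and> k \<le> n \<longrightarrow>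
                   card {x \<in> C. card x = k} = 1} :: nat set set set"
  \<comment> \<open>The summand 2 offsets the one in the range \<open>n - A n + 2\<close> of
    \<open>prob_single_levels\<close>, and also gives \<open>2 \<le> A n\<close>.\<close>
  define A where "A n = nat \<lceil>real n powr a\<rceil> + 2" for n
  define e where "e n = (real (A n))\<^sup>2 / real n" for n
  have A_ge: "real n powr a + 2 \<le> real (A n)" and A_le: "real (A n) \<le> real n powr a + 3" for n
  proof -
    have "0 \<le> real n powr a" by simp
    then show "real n powr a + 2 \<le> real (A n)" "real (A n) \<le> real n powr a + 3"
      unfolding A_def by linarith+
  qed
  have e_lim: "e \<longlonglongrightarrow> 0"
  proof (rule tendsto_sandwich[OF _ _ tendsto_const])
    show "\<forall>\<^sub>F n in sequentially. 0 \<le> e n" by (simp add: e_def)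
    show "\<forall>\<^sub>F n in sequentially. e n \<le>
        real n powr (2 * a - 1) + 6 * real n powr (a - 1) + 9 * real n powr (- 1)"
    proof (rule eventually_mono[OF eventually_gt_at_top[of 0]])
      fix n :: nat assume n: "0 < n"
      have "e n \<le> (real n powr a + 3)\<^sup>2 / real n"
        unfolding e_def using A_le[of n] by (intro divide_right_mono power_mono) auto
      also have "\<dots> = real n powr (2 * a - 1) + 6 * real n powr (a - 1) + 9 * real n powr (- 1)"
      proof -
        have "real n powr (2 * a - 1) = real n powr a * real n powr a / real n"
          using n by (simp add: powr_diff powr_add[symmetric])
        moreover have "real n powr (a - 1) = real n powr a / real n"
          using n by (simp add: powr_diff)
        moreover have "real n powr (- 1) = 1 / real n" using n by (simp add: powr_minus_divide)
        ultimately show ?thesis by (simp add: power2_eq_square field_simps add_divide_distrib)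
      qed
      finally show "e n \<le> real n powr (2 * a - 1) + 6 * real n powr (a - 1) + 9 * real n powr (- 1)" .
    qed
    have "(\<lambda>n. real n powr p) \<longlonglongrightarrow> 0" if "p < 0" for p
      using that by (intro tendsto_neg_powr filterlim_real_sequentially)
    from this[of "2 * a - 1"] this[of "a - 1"] this[of "- 1"]
    show "(\<lambda>n. real n powr (2 * a - 1) + 6 * real n powr (a - 1) + 9 * real n powr (- 1)) \<longlonglongrightarrow> 0"
      using assms by (intro tendsto_add_zero tendsto_mult_right_zero) auto
  qed
  \<comment> \<open>This yields the smallness condition on \<rho>, because A / n \<le> A^2 / n =
    \<open>e n\<close>.\<close>
  have small: "\<forall>\<^sub>F n in sequentially. e n < 1 / (5971968 * 24)"
    using e_lim by (rule order_tendstoD) simp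
  show ?thesis
  proof (rule tendsto_sandwich[OF _ _ _ tendsto_const])
    show "(\<lambda>n. 1 - 143327328 * e n) \<longlonglongrightarrow> 1"
      using tendsto_diff[OF tendsto_const[of 1] tendsto_mult_right_zero[OF e_lim, of 143327328]] by simp
    show "\<forall>\<^sub>F n in sequentially. 1 - 143327328 * e n \<le> measure_pmf.prob (dla_final n) (?G n)"
      using small eventually_gt_at_top[of 0]
    proof eventually_elim
      case (elim n)
      have A2: "2 \<le> A n" by (simp add: A_def)
      have "1 * real (A n) \<le> real (A n) * real (A n)"
        using A2 by (intro mult_right_mono) auto
      then have "real (A n) / real n \<le> e n"
        unfolding e_def power2_eq_square by (intro divide_right_mono) auto
      moreover have "5971968 * (24 * real (A n) / real n) = 143327232 * (real (A n) / real n)" by simp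
      ultimately have sm: "5971968 * (24 * real (A n) / real n) \<le> 1" using elim(1) by linarith
      \<comment> \<open>Ensures that the natural-number subtraction \<open>n - A n\<close> is not
        truncated.\<close>
      have "24 * A n \<le> n"
        using twentyfour_A_le[OF _ refl sm elim(2)] A2 by simp
      have "1 - 143327328 * e n \<le> measure_pmf.prob (dla_final n)
          {C. \<forall>k. n - A n + 2 \<le> k \<and> k \<le> n \<longrightarrow> level_count k C = 1}"
        unfolding e_def by (rule prob_single_levels[OF A2 elim(2) sm])
      also have "\<dots> \<le> measure_pmf.prob (dla_final n) (?G n)"
      proof (rule measure_pmf.finite_measure_mono)
        have "n - A n + 2 \<le> k" if "real n - real n powr a \<le> real k" for k
        proof -
          have "real n + 2 \<le> real k + real (A n)" using that A_ge[of n] by linarith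
          then show ?thesis using \<open>24 * A n \<le> n\<close> by linarith
        qed
        then show "{C. \<forall>k. n - A n + 2 \<le> k \<and> k \<le> n \<longrightarrow> level_count k C = 1} \<subseteq> ?G n"
          unfolding level_count_def by blast
      qed simp
      finally show ?case .
    qed
  qed (auto intro: always_eventually)
qed

end
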